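(* Let $d\ge1$, let $w:\mathbb{N}\to\mathbb{R}^+$ satisfy $\sum_{j=0}^{+\infty}2^{-dj}\lfloor w(j)\rfloor<+\infty$ (that is, $\mathcal{F}_w^{(d)}$ is an $L^1$-ball of prediction rules), let $0<a\le A<+\infty$ and $0<h\le1$. Let $\pi$ be a probability measure on $[0,1]^d\times\{-1,1\}$, with marginal $P^X$ on $[0,1]^d$ and $\eta(x)=\mathbb{P}(Y=1\mid X=x)$, such that: (A1) $P^X$ is absolutely continuous with respect to $\lambda_d$ and $a\le \frac{dP^X}{d\lambda_d}(x)\le A$ for all $x\in[0,1]^d$; (SMA) $\mathbb{P}(|2\eta(X)-1|\ge h)=1$; and the Bayes rule $f^*$ associated to $\pi$ belongs to $\mathcal{F}_w^{(d)}$. Then for every integer $n\ge1$ and every $\epsilon>0$, $$\mathcal{E}_\pi\big(\hat f_n^{(J_\epsilon)}\big)=\mathbb{E}_\pi\big[d_\pi(\hat f_n^{(J_\epsilon)},f^* )\big]\le(1+A)\epsilon+\exp\Big(-na\big(1-\exp(-h^2/2)\big)2^{-dJ_\epsilon}\Big),$$ where $J_\epsilon$ is the smallest integer $J\in\mathbb{N}$ satisfying $\sum_{j=J+1}^{+\infty}2^{-dj}\lfloor w(j)\rfloor<\epsilon/A$.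
   Context: Notation: $\mathbb{N}=\{0,1,2,\dots\}$, $\mathbb{R}^+=[0,\infty)$, $\lambda_d$ is Lebesgue measure on $[0,1]^d$. Dyadic system. For $j\in\mathbb{N}$ let $I_d(j)=\{0,\dots,2^j-1\}^d$. Let $I_k^{(j)}=[k2^{-j},(k+1)2^{-j})$ for $0\le k\le 2^j-2$ and $I_{2^j-1}^{(j)}=[(2^j-1)2^{-j},1]$. For $\mathbf{k}=(k_1,\dots,k_d)\in I_d(j)$ let $\mathcal{I}_{\mathbf{k}}^{(j)}=I_{k_1}^{(j)}\times\dots\times I_{k_d}^{(j)}$ (a dyadic cell of frequency $j$) and $\phi_{\mathbf{k}}^{(j)}=\mathbf{1}_{\mathcal{I}_{\mathbf{k}}^{(j)}}$. Writing convention (W). An expansion $f=\sum_{j\ge0}\sum_{\mathbf{k}\in I_d(j)}a_{\mathbf{k}}^{(j)}\phi_{\mathbf{k}}^{(j)}$ ($\lambda_d$-a.e.; at each point only finitely many terms are nonzero) of a measurable function $f:[0,1]^d\to\{-1,1\}$ with $a_{\mathbf{k}}^{(j)}\in\{-1,0,1\}$ satisfies (W) if: (1) whenever $a_{\mathbf{k}}^{(j)}\ne0$, all coefficients of dyadic cells of higher frequency contained in $\mathcal{I}_{\mathbf{k}}^{(j)}$ are $0$; (2) low frequencies are preferred whenever possible: whenever $f$ is $\lambda_d$-a.e. constant on a dyadic cell, that cell or a dyadic cell containing it has a nonzero coefficient (in particular the $2^d$ subcells of frequency $j+1$ of a cell of frequency $j$ never all carry the same nonzero coefficient). Such an expansion,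 if it exists, is unique. Class $\mathcal{F}_w^{(d)}$: for $w:\mathbb{N}\to\mathbb{R}^+$, the set of functions $f:[0,1]^d\to\{-1,1\}$ admitting an expansion satisfying (W) with $\mathrm{card}\{\mathbf{k}\in I_d(j):a_{\mathbf{k}}^{(j)}\neq0\}\le w(j)$ for all $j\in\mathbb{N}$ (functions are identified when equal $\lambda_d$-a.e.). Classification. $(X,Y)$ has law $\pi$. For a measurable $f:[0,1]^d\to\{-1,1\}$ (prediction rule), $R(f)=\mathbb{P}(f(X)\ne Y)$; $d_\pi(f,g)=|R(f)-R(g)|$. The Bayes rule is $f^*=\mathrm{sign}(2\eta-1)$ and $R^*=R(f^* )=\min_fR(f)$. The data are $D_n=(X_i,Y_i)_{1\le i\le n}$, i.i.d. with law $\pi$. For a classifier $\hat f_n$ (a prediction rule built from $D_n$), $R(\hat f_n)=\mathbb{P}(\hat f_n(X)\ne Y\mid D_n)$ with $(X,Y)$ independent of $D_n$, and the excess risk is $\mathcal{E}_\pi(\hat f_n)=\mathbb{E}_\pi[R(\hat f_n)-R^*]$, the expectation being over $D_n$. Estimator. For $J\in\mathbb{N}$, $\hat f_n^{(J)}=\sum_{\mathbf{k}\in I_d(J)}\hat A_{\mathbf{k}}^{(J)}\phi_{\mathbf{k}}^{(J)}$, where $\hat A_{\mathbf{k}}^{(J)}=1$ if at least one $X_i$ lies in $\mathcal{I}_{\mathbf{k}}^{(J)}$ and $\mathrm{card}\{i:X_i\in\mathcal{I}_{\mathbf{k}}^{(J)},Y_i=1\}>\mathrm{card}\{i:X_i\in\mathcal{I}_{\mathbf{k}}^{(J)},Y_i=-1\}$,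 and $\hat A_{\mathbf{k}}^{(J)}=-1$ otherwise. *)

theory Defs
  imports "HOL-Probability.Probability"
begin

abbreviation unit_cube :: "(real ^ 'd) set" where
  "unit_cube \<equiv> cbox 0 1"

definition lebesgue_cube :: "(real ^ 'd) measure" where
  "lebesgue_cube = restrict_space lborel unit_cube"

definition dyadic_index :: "nat \<Rightarrow> (nat ^ 'd) set" where
  "dyadic_index j = {k. \<forall>i. k $ i < 2 ^ j}"

definition dyadic_interval :: "nat \<Rightarrow> nat \<Rightarrow> real set" where
  "dyadic_interval j k =
     (if k = 2 ^ j - 1 then {real k / 2 ^ j .. 1}
      else {real k / 2 ^ j ..< (real k + 1) / 2 ^ j})"

definition dyadic_cell :: "nat \<Rightarrow> nat ^ 'd \<Rightarrow> (real ^ 'd) set" where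
  "dyadic_cell j k = {x. \<forall>i. x $ i \<in> dyadic_interval j (k $ i)}"

abbreviation \<phi> :: "nat \<Rightarrow> nat ^ 'd \<Rightarrow> real ^ 'd \<Rightarrow> real" where
  "\<phi> j k \<equiv> indicator (dyadic_cell j k)"

definition prediction_rules :: "(real ^ 'd \<Rightarrow> real) set" where
  "prediction_rules = lebesgue_cube \<rightarrow>\<^sub>M count_space {-1, 1}"

definition dyadic_expansion ::
    "(nat \<Rightarrow> nat ^ 'd \<Rightarrow> real) \<Rightarrow> (real ^ 'd \<Rightarrow> real) \<Rightarrow> bool" where
  "dyadic_expansion a f \<longleftrightarrow>
     (\<forall>j. \<forall>k\<in>dyadic_index j. a j k \<in> {-1, 0, 1}) \<and>
     (\<forall>x\<in>unit_cube. finite {(j, k). k \<in> dyadic_index j \<and> a j k * \<phi> j k x \<noteq> 0}) \<and>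
     (AE x in lebesgue_cube. (\<lambda>j. \<Sum>k\<in>dyadic_index j. a j k * \<phi> j k x) sums f x)"

text \<open>Nonzero cells are never nested, and low frequencies are preferred: a cell on which \<open>f\<close> is
  almost everywhere constant lies in a cell with nonzero coefficient.  In particular the \<open>2 ^ d\<close>
  subcells of a cell never all carry the same nonzero coefficient.\<close>

definition writing_convention ::
    "(nat \<Rightarrow> nat ^ 'd \<Rightarrow> real) \<Rightarrow> (real ^ 'd \<Rightarrow> real) \<Rightarrow> bool" where
  "writing_convention a f \<longleftrightarrow>
     (\<forall>j. \<forall>k\<in>dyadic_index j. a j k \<noteq> 0 \<longrightarrow>
        (\<forall>j'>j. \<forall>k'\<in>dyadic_index j'. dyadic_cell j' k' \<subseteq> dyadic_cell j k \<longrightarrow> a j' k' = 0)) \<and>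
     (\<forall>j. \<forall>k\<in>dyadic_index j.
        (\<exists>c. AE x in lebesgue_cube. x \<in> dyadic_cell j k \<longrightarrow> f x = c) \<longrightarrow>
        (\<exists>j'. \<exists>k'\<in>dyadic_index j'. dyadic_cell j k \<subseteq> dyadic_cell j' k' \<and> a j' k' \<noteq> 0))"

definition dyadic_class :: "(nat \<Rightarrow> real) \<Rightarrow> (real ^ 'd \<Rightarrow> real) set" where
  "dyadic_class w = {f \<in> prediction_rules. \<exists>a.
     dyadic_expansion a f \<and> writing_convention a f \<and>
     (\<forall>j. real (card {k \<in> dyadic_index j. a j k \<noteq> 0}) \<le> w j)}"

definition sample_space :: "((real ^ 'd) \<times> real) measure" where
  "sample_space = lebesgue_cube \<Otimes>\<^sub>M count_space {-1, 1}"

definition marginal :: "((real ^ 'd) \<times> real) measure \<Rightarrow> (real ^ 'd) measure" where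
  "marginal \<pi> = distr \<pi> lebesgue_cube fst"

text \<open>\<open>\<eta>\<close> is a version of the conditional probability of \<open>Y = 1\<close> given \<open>X = x\<close>:
  composed with \<open>X\<close>, it is the conditional expectation of the indicator of \<open>Y = 1\<close>
  given the \<open>\<sigma>\<close>-algebra generated by \<open>X\<close>.\<close>

definition regression_function ::
    "((real ^ 'd) \<times> real) measure \<Rightarrow> (real ^ 'd \<Rightarrow> real) \<Rightarrow> bool" where
  "regression_function \<pi> \<eta> \<longleftrightarrow>
     \<eta> \<in> borel_measurable lebesgue_cube \<and>
     (AE z in \<pi>. \<eta> (fst z) =
        real_cond_exp \<pi> (vimage_algebra (space \<pi>) fst lebesgue_cube) (indicator {z. snd z = 1}) z)"

text \<open>Prediction rules take values in \<open>{-1, 1}\<close>, so the sign of \<open>0\<close> is taken to be \<open>1\<close> here.\<close>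

definition bayes_rule :: "(real ^ 'd \<Rightarrow> real) \<Rightarrow> real ^ 'd \<Rightarrow> real" where
  "bayes_rule \<eta> x = (if 2 * \<eta> x - 1 \<ge> 0 then 1 else -1)"

definition risk :: "((real ^ 'd) \<times> real) measure \<Rightarrow> (real ^ 'd \<Rightarrow> real) \<Rightarrow> real" where
  "risk \<pi> f = measure \<pi> {z \<in> space \<pi>. f (fst z) \<noteq> snd z}"

definition bayes_risk :: "((real ^ 'd) \<times> real) measure \<Rightarrow> real" where
  "bayes_risk \<pi> = (INF f\<in>prediction_rules. risk \<pi> f)"

definition risk_dist ::
    "((real ^ 'd) \<times> real) measure \<Rightarrow> (real ^ 'd \<Rightarrow> real) \<Rightarrow> (real ^ 'd \<Rightarrow> real) \<Rightarrow> real" where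
  "risk_dist \<pi> f g = \<bar>risk \<pi> f - risk \<pi> g\<bar>"

definition data_law :: "((real ^ 'd) \<times> real) measure \<Rightarrow> nat \<Rightarrow> (nat \<Rightarrow> (real ^ 'd) \<times> real) measure" where
  "data_law \<pi> n = (\<Pi>\<^sub>M i\<in>{1..n}. \<pi>)"

text \<open>A classifier maps a data set to a prediction rule. Given the data \<open>D\<close>, the conditional
  error probability of \<open>fhat D\<close> on an independent pair with law \<open>\<pi>\<close> is \<open>risk \<pi> (fhat D)\<close>.\<close>

definition excess_risk ::
    "((real ^ 'd) \<times> real) measure \<Rightarrow> nat \<Rightarrow>
     ((nat \<Rightarrow> (real ^ 'd) \<times> real) \<Rightarrow> real ^ 'd \<Rightarrow> real) \<Rightarrow> real" where
  "excess_risk \<pi> n fhat = (LINT D|data_law \<pi> n. (risk \<pi> (fhat D) - bayes_risk \<pi>))"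

definition estimator_coeff ::
    "nat \<Rightarrow> nat \<Rightarrow> (nat \<Rightarrow> (real ^ 'd) \<times> real) \<Rightarrow> nat ^ 'd \<Rightarrow> real" where
  "estimator_coeff n J D k =
     (if (\<exists>i\<in>{1..n}. fst (D i) \<in> dyadic_cell J k) \<and>
         card {i \<in> {1..n}. fst (D i) \<in> dyadic_cell J k \<and> snd (D i) = 1}
           > card {i \<in> {1..n}. fst (D i) \<in> dyadic_cell J k \<and> snd (D i) = -1}
      then 1 else -1)"

definition estimator ::
    "nat \<Rightarrow> nat \<Rightarrow> (nat \<Rightarrow> (real ^ 'd) \<times> real) \<Rightarrow> real ^ 'd \<Rightarrow> real" where
  "estimator n J D x = (\<Sum>k\<in>dyadic_index J. estimator_coeff n J D k * \<phi> J k x)"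

definition weight :: "nat \<Rightarrow> (nat \<Rightarrow> real) \<Rightarrow> nat \<Rightarrow> real" where
  "weight d w j = of_int \<lfloor>w j\<rfloor> / 2 ^ (d * j)"

definition J_eps :: "nat \<Rightarrow> (nat \<Rightarrow> real) \<Rightarrow> real \<Rightarrow> real \<Rightarrow> nat" where
  "J_eps d w A \<epsilon> = (LEAST J. (\<Sum>i. weight d w (i + (J + 1))) < \<epsilon> / A)"

end

theory Submission
  imports Defs
begin

text \<open>Write \<open>f\<^sup>*\<close> for the Bayes rule and \<open>J\<close> for the cut-off frequency. The cells of frequency \<open>J\<close>
  lying in a cell with nonzero coefficient of frequency at most \<open>J\<close> are cells on which \<open>f\<^sup>*\<close> is
  almost everywhere constant; the remaining ones are covered, up to a null set, by the cells with
  nonzero coefficient of frequency above \<open>J\<close>, whose total Lebesgue measure is below \<open>\<epsilon> / A\<close>.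
  The excess risk is at most the probability that the estimator and \<open>f\<^sup>*\<close> disagree. The remaining
  cells contribute at most \<open>\<epsilon>\<close> to it. On a cell of probability \<open>q\<close> where \<open>f\<^sup>*\<close> is constant, the
  majority vote is wrong with probability at most
  \<open>(1 - q * (1 - exp (- h\<^sup>2 / 2))) ^ n\<close>, by the exponential Markov inequality with parameter \<open>h\<close>
  and the margin assumption, and \<open>q \<ge> a / 2 ^ (d * J)\<close>.\<close>

section \<open>Dyadic cells\<close>

text \<open>Clearing the denominator lets one formula cover both shapes of interval. Below the last
  index the right endpoint is at most 1, so \<open>t \<le> 1\<close> is automatic; at the last index
  it takes the place of the strict upper bound.\<close>

lemma dyadic_interval_iff:
  assumes "k < 2 ^ j"
  shows "t \<in> dyadic_interval j k \<longleftrightarrow>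
    real k \<le> 2 ^ j * t \<and> t \<le> 1 \<and> (2 ^ j * t < real k + 1 \<or> k = 2 ^ j - 1)"
proof -
  have "real k + 1 \<le> 2 ^ j"
    using assms by (metis Suc_leI of_nat_Suc of_nat_le_iff of_nat_numeral of_nat_power add.commute)
  moreover have "2 ^ j * t < real k + 1 \<Longrightarrow> t \<le> 1"
  proof -
    assume "2 ^ j * t < real k + 1"
    with \<open>real k + 1 \<le> 2 ^ j\<close> have "2 ^ j * t < 2 ^ j * 1" by linarith
    thus "t \<le> 1" by (subst (asm) mult_less_cancel_left_pos) auto
  qed
  ultimately show ?thesis
    by (auto simp: dyadic_interval_def field_simps)
qed

text \<open>At the last index \<open>(k + 1) / 2 ^ j\<close> equals 1, so the closed interval fits
  the same endpoints. Together with the next inclusion this sandwiches a cell between an open and a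
  closed box of equal volume.\<close>

lemma dyadic_interval_subset: "dyadic_interval j k \<subseteq> {real k / 2 ^ j..(real k + 1) / 2 ^ j}"
  by (auto simp: dyadic_interval_def of_nat_diff field_simps)

lemma dyadic_interval_superset: "{real k / 2 ^ j<..<(real k + 1) / 2 ^ j} \<subseteq> dyadic_interval j k"
  by (auto simp: dyadic_interval_def of_nat_diff field_simps)

lemma dyadic_interval_inj:
  assumes "k < 2 ^ j" "k' < 2 ^ j" "t \<in> dyadic_interval j k" "t \<in> dyadic_interval j k'"
  shows "k = k'"
proof -
  have *: "2 ^ j * t < real l + 1 \<Longrightarrow> real l' \<le> 2 ^ j * t \<Longrightarrow> l' \<le> l" for l l'
    by linarith
  \<comment> \<open>When the strict upper bound is missing, the index is the largest one and
    dominates the other by its range alone.\<close>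
  show ?thesis
    using assms(3,4) *[of k k'] *[of k' k] assms(1,2)
    unfolding dyadic_interval_iff[OF assms(1)] dyadic_interval_iff[OF assms(2)]
    by (metis Suc_pred' le_antisym less_Suc_eq_le zero_less_numeral zero_less_power)
qed

lemma dyadic_interval_cover:
  assumes "0 \<le> t" "t \<le> 1"
  obtains k where "k < 2 ^ j" "t \<in> dyadic_interval j k"
proof (cases "t = 1")
  case True
  show ?thesis
    by (rule that[of "2 ^ j - 1"]) (use True in \<open>auto simp: dyadic_interval_iff of_nat_diff\<close>)
next
  case False
  define k where "k = nat \<lfloor>2 ^ j * t\<rfloor>"
  have k: "real k \<le> 2 ^ j * t" "2 ^ j * t < real k + 1"
    using assms unfolding k_def by (simp_all add: of_nat_nat)
  have "2 ^ j * t < 2 ^ j" using False assms by simp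
  hence "real k < 2 ^ j" using k by linarith
  hence "k < 2 ^ j" by (metis of_nat_less_iff of_nat_numeral of_nat_power)
  thus ?thesis using that k assms by (auto simp: dyadic_interval_iff)
qed

text \<open>Dividing the index by \<open>2 ^ (j' - j)\<close> passes from an interval to its
  ancestor at the coarser frequency.\<close>

lemma dyadic_interval_parent:
  assumes "j \<le> j'" "k < 2 ^ j'"
  shows "k div 2 ^ (j' - j) < 2 ^ j"
    and "dyadic_interval j' k \<subseteq> dyadic_interval j (k div 2 ^ (j' - j))"
proof -
  define m where "m = (2::nat) ^ (j' - j)"
  define q where "q = k div m"
  have m: "m > 0" "(2::nat) ^ j' = m * 2 ^ j" "(2::real) ^ j' = real m * 2 ^ j"
    using assms(1) by (auto simp: m_def simp flip: power_add)
  show q_less: "k div 2 ^ (j' - j) < 2 ^ j"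
    using assms(2) m unfolding m_def[symmetric] by (simp add: less_mult_imp_div_less mult.commute)
  have lower: "real m * real q \<le> real k"
    unfolding q_def by (simp flip: of_nat_mult)
  have "k < m * (q + 1)"
    using m(1) unfolding q_def by (metis Suc_eq_plus1 dividend_less_times_div mult_Suc_right add.commute)
  hence upper: "real k + 1 \<le> real m * (real q + 1)"
    by (metis Suc_leI of_nat_1 of_nat_Suc of_nat_add of_nat_le_iff of_nat_mult add.commute)
  show "dyadic_interval j' k \<subseteq> dyadic_interval j (k div 2 ^ (j' - j))"
  proof
    fix t assume "t \<in> dyadic_interval j' k"
    hence t: "real k \<le> real m * (2 ^ j * t)" "t \<le> 1"
        "real m * (2 ^ j * t) < real k + 1 \<or> k = 2 ^ j' - 1"
      using dyadic_interval_iff[OF assms(2)] m by (auto simp: mult.assoc)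
    have 1: "real q \<le> 2 ^ j * t"
      using order_trans[OF lower t(1)] m(1) by (subst (asm) mult_le_cancel_left_pos) auto
    have 2: "2 ^ j * t < real q + 1 \<or> q = 2 ^ j - 1"
    \<comment> \<open>Only the last fine interval contains its right endpoint. Its ancestor must be
      the last coarse interval, which contains 1 as well.\<close>
    proof (cases "k = 2 ^ j' - 1")
      case True
      have "m * 2 ^ j \<le> m * (q + 1)"
        using \<open>k < m * (q + 1)\<close> True m(2) by linarith
      hence "2 ^ j \<le> q + 1" using m(1) by (metis mult_le_cancel1)
      moreover have "q < 2 ^ j" using q_less by (simp add: q_def m_def)
      ultimately show ?thesis by linarith
    next
      case False
      hence "real m * (2 ^ j * t) < real m * (real q + 1)" using t(3) upper by linarith
      thus ?thesis using m(1) by (subst (asm) mult_less_cancel_left_pos) auto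
    qed
    show "t \<in> dyadic_interval j (k div 2 ^ (j' - j))"
      unfolding dyadic_interval_iff[OF q_less] using 1 2 t(2) by (simp add: q_def m_def)
  qed
qed

lemma finite_dyadic_index [simp]: "finite (dyadic_index j :: (nat ^ 'd) set)"
proof -
  have "dyadic_index j \<subseteq> (vec_lambda :: ('d \<Rightarrow> nat) \<Rightarrow> _) ` (UNIV \<rightarrow>\<^sub>E {..<2 ^ j})"
  proof
    fix k :: "nat ^ 'd" assume "k \<in> dyadic_index j"
    hence "(\<lambda>i. k $ i) \<in> UNIV \<rightarrow>\<^sub>E {..<2 ^ j}" by (auto simp: dyadic_index_def)
    thus "k \<in> vec_lambda ` (UNIV \<rightarrow>\<^sub>E {..<2 ^ j})" by (metis imageI vec_lambda_eta)
  qed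
  thus ?thesis by (rule finite_subset) (intro finite_imageI finite_PiE, auto)
qed

lemma dyadic_cell_inj:
  assumes "k \<in> dyadic_index j" "k' \<in> dyadic_index j" "x \<in> dyadic_cell j k" "x \<in> dyadic_cell j k'"
  shows "k = k'"
  using assms dyadic_interval_inj unfolding dyadic_index_def dyadic_cell_def vec_eq_iff by blast

lemma dyadic_cell_cover:
  assumes "x \<in> unit_cube"
  obtains k where "k \<in> dyadic_index j" "x \<in> dyadic_cell j k"
proof -
  have "\<exists>k. k < 2 ^ j \<and> x $ i \<in> dyadic_interval j k" for i
    using assms dyadic_interval_cover[of "x $ i" j] by (auto simp: mem_box_cart)
  then obtain \<kappa> where "\<And>i. \<kappa> i < 2 ^ j \<and> x $ i \<in> dyadic_interval j (\<kappa> i)" by metis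
  thus ?thesis by (intro that[of "vec_lambda \<kappa>"]) (auto simp: dyadic_index_def dyadic_cell_def)
qed

lemma dyadic_cell_subset_unit_cube:
  assumes "k \<in> dyadic_index j"
  shows "dyadic_cell j k \<subseteq> unit_cube"
proof
  fix x assume x: "x \<in> dyadic_cell j k"
  have "0 \<le> x $ i \<and> x $ i \<le> 1" for i
  proof -
    have "k $ i < 2 ^ j" "x $ i \<in> dyadic_interval j (k $ i)"
      using assms x by (auto simp: dyadic_index_def dyadic_cell_def)
    hence *: "real (k $ i) \<le> 2 ^ j * x $ i" "x $ i \<le> 1" by (auto simp: dyadic_interval_iff)
    hence "0 \<le> 2 ^ j * x $ i" by (metis of_nat_0_le_iff order_trans)
    thus ?thesis using * by (auto simp: zero_le_mult_iff dest: leD)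
  qed
  thus "x \<in> unit_cube" by (auto simp: mem_box_cart)
qed

text \<open>The coordinatewise ancestor \<open>q\<close> of \<open>k'\<close> contains the fine
  cell. The common point then lies in the frequency-\<open>j\<close> cells of both \<open>q\<close>
  and \<open>k\<close>, which forces \<open>q = k\<close>.\<close>

lemma dyadic_cell_nested:
  fixes k k' :: "nat ^ 'd"
  assumes "j \<le> j'" "k \<in> dyadic_index j" "k' \<in> dyadic_index j'"
    and x: "x \<in> dyadic_cell j k" "x \<in> dyadic_cell j' k'"
  shows "dyadic_cell j' k' \<subseteq> dyadic_cell j k"
proof -
  define q :: "nat ^ 'd" where "q = (\<chi> i. k' $ i div 2 ^ (j' - j))"
  have k': "k' $ i < 2 ^ j'" for i using assms(3) by (auto simp: dyadic_index_def)
  have q: "q \<in> dyadic_index j"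
    using dyadic_interval_parent(1)[OF assms(1) k'] by (auto simp: dyadic_index_def q_def)
  have sub: "dyadic_cell j' k' \<subseteq> dyadic_cell j q"
    using dyadic_interval_parent(2)[OF assms(1) k'] by (auto simp: dyadic_cell_def q_def)
  with x have "q = k" by (intro dyadic_cell_inj[OF q assms(2)]) auto
  with sub show ?thesis by simp
qed

section \<open>Lebesgue measure on the cube and the measure of a cell\<close>

lemma space_lebesgue_cube [simp]: "space lebesgue_cube = unit_cube"
  by (simp add: lebesgue_cube_def space_restrict_space)

lemma sets_lebesgue_cube_iff:
  "S \<in> sets lebesgue_cube \<longleftrightarrow> S \<in> sets borel \<and> S \<subseteq> unit_cube"
  unfolding lebesgue_cube_def by (subst sets_restrict_space_iff) auto

lemma emeasure_lebesgue_cube: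
  "S \<subseteq> unit_cube \<Longrightarrow> emeasure lebesgue_cube S = emeasure lborel S"
  unfolding lebesgue_cube_def by (subst emeasure_restrict_space) auto

lemma dyadic_cell_measurable [measurable]: "dyadic_cell j k \<in> sets borel"
proof -
  have "dyadic_interval j l \<in> sets borel" for l by (auto simp: dyadic_interval_def)
  moreover have "dyadic_cell j k = (\<Inter>i. (\<lambda>x. x $ i) -` dyadic_interval j (k $ i) \<inter> space borel)"
    by (auto simp: dyadic_cell_def)
  ultimately show ?thesis
    by (simp only:) (intro sets.countable_INT'' measurable_sets[of _ borel borel] 
        borel_measurable_continuous_onI continuous_intros, auto)
qed

lemma sets_dyadic_cell: "k \<in> dyadic_index j \<Longrightarrow> dyadic_cell j k \<in> sets lebesgue_cube"
  using dyadic_cell_subset_unit_cube by (auto simp: sets_lebesgue_cube_iff)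

lemma emeasure_dyadic_cell:
  fixes k :: "nat ^ 'd"
  assumes "k \<in> dyadic_index j"
  shows "emeasure lebesgue_cube (dyadic_cell j k) = ennreal (1 / 2 ^ (CARD('d) * j))"
proof -
  define l u :: "real ^ 'd" where "l = (\<chi> i. real (k $ i) / 2 ^ j)" and "u = (\<chi> i. (real (k $ i) + 1) / 2 ^ j)"
  have diff: "(u - l) $ i = 1 / 2 ^ j" for i
    by (simp add: l_def u_def field_simps)
  have le: "l \<bullet> b \<le> u \<bullet> b" if b: "b \<in> Basis" for b
  proof -
    obtain i where "b = axis i 1" using b by (auto simp: Basis_vec_def)
    thus ?thesis using diff[of i] by (simp add: inner_axis) (smt (verit) divide_nonneg_nonneg zero_le_power)
  qed
  have prod: "(\<Prod>b\<in>Basis. (u - l) \<bullet> b) = 1 / 2 ^ (CARD('d) * j)"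
  proof -
    have "(\<Prod>b\<in>Basis. (u - l) \<bullet> b) = (\<Prod>b\<in>(Basis :: (real ^ 'd) set). 1 / 2 ^ j)"
    proof (rule prod.cong[OF refl])
      fix b :: "real ^ 'd" assume "b \<in> Basis"
      then obtain i where "b = axis i 1" by (auto simp: Basis_vec_def)
      thus "(u - l) \<bullet> b = 1 / 2 ^ j" using diff[of i] by (simp only: inner_axis) simp
    qed
    also have "\<dots> = 1 / 2 ^ (CARD('d) * j)"
      by (simp add: power_divide mult.commute flip: power_mult)
    finally show ?thesis .
  qed
  have "box l u \<subseteq> dyadic_cell j k"
    using dyadic_interval_superset[where j = j]
    by (fastforce simp: dyadic_cell_def mem_box_cart l_def u_def)
  moreover have "dyadic_cell j k \<subseteq> cbox l u"
    using dyadic_interval_subset[of j] by (fastforce simp: dyadic_cell_def mem_box_cart l_def u_def)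
  ultimately have "emeasure lborel (box l u) \<le> emeasure lborel (dyadic_cell j k)"
      "emeasure lborel (dyadic_cell j k) \<le> emeasure lborel (cbox l u)"
    by (auto intro!: emeasure_mono)
  thus ?thesis
    using prod dyadic_cell_subset_unit_cube[OF assms]
    by (simp add: emeasure_lborel_box[OF le] emeasure_lborel_cbox[OF le] emeasure_lebesgue_cube)
qed

section \<open>Dyadic expansions cut off at a fixed frequency\<close>

text \<open>On a cell with nonzero coefficient every other term of the series vanishes, so the sum
  reduces to that coefficient.\<close>

lemma dyadic_expansion_AE_constant:
  fixes f :: "real ^ 'd \<Rightarrow> real"
  assumes exp: "dyadic_expansion b f" and wc: "writing_convention b f"
    and k: "k \<in> dyadic_index j" "b j k \<noteq> 0"
  shows "AE x in lebesgue_cube. x \<in> dyadic_cell j k \<longrightarrow> f x = b j k"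
proof -
  \<comment> \<open>Cells of different frequencies that meet are nested, so the non-nesting clause
    excludes two nonzero coefficients at one point; a coarser nonzero one would force
    \<open>b j k = 0\<close>. Distinct cells of equal frequency never meet.\<close>
  have zero: "b j' k' = 0" if k': "k' \<in> dyadic_index j'" and ne: "(j', k') \<noteq> (j, k)"
    and x: "x \<in> dyadic_cell j' k'" "x \<in> dyadic_cell j k" for j' k' x
  proof (cases j' j rule: linorder_cases)
    case less
    show ?thesis
      using wc k k' less dyadic_cell_nested[of j' j k' k x] x
      unfolding writing_convention_def by (meson less_imp_le)
  next
    case equal
    thus ?thesis using dyadic_cell_inj[of k j k' x] k(1) k' x ne by auto
  next
    case greater
    show ?thesis
      using wc k k' greater dyadic_cell_nested[of j j' k k' x] x
      unfolding writing_convention_def by (meson less_imp_le)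
  qed
  have level: "(\<Sum>k'\<in>dyadic_index j'. b j' k' * \<phi> j' k' x) = (if j' = j then b j k else 0)"
    if x: "x \<in> dyadic_cell j k" for j' x
  proof (cases "j' = j")
    case True
    have "(\<Sum>k'\<in>dyadic_index j. b j k' * \<phi> j k' x) = (\<Sum>k'\<in>dyadic_index j. if k' = k then b j k else 0)"
      using zero x by (intro sum.cong) (auto simp: indicator_def)
    also have "\<dots> = b j k" using k(1) by simp
    finally show ?thesis using True by simp
  next
    case False
    thus ?thesis using zero[OF _ _ _ x] by (auto simp: indicator_def intro!: sum.neutral)
  qed
  have "AE x in lebesgue_cube. (\<lambda>j. \<Sum>k\<in>dyadic_index j. b j k * \<phi> j k x) sums f x"
    using exp by (simp add: dyadic_expansion_def)
  thus ?thesis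
  proof eventually_elim
    case (elim x)
    show ?case
    proof
      assume "x \<in> dyadic_cell j k"
      hence "(\<lambda>j'. if j' = j then b j k else 0) sums f x"
        using elim level by simp
      moreover have "(\<lambda>j'. if j' = j then b j k else 0) sums b j k"
        using sums_single[of j "\<lambda>_. b j k"] by simp
      ultimately show "f x = b j k" by (rule sums_unique2)
    qed
  qed
qed

definition dyadic_level :: "(nat \<Rightarrow> nat ^ 'd \<Rightarrow> real) \<Rightarrow> nat \<Rightarrow> (real ^ 'd) set" where
  "dyadic_level b j = (\<Union>k\<in>{k \<in> dyadic_index j. b j k \<noteq> 0}. dyadic_cell j k)"

lemma sets_dyadic_level [measurable]: "dyadic_level b j \<in> sets lebesgue_cube"
  unfolding dyadic_level_def by (intro sets.finite_UN) (auto intro: sets_dyadic_cell)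

text \<open>A prediction rule never takes the value 0, while at a point outside all levels every
  term of the series is 0.\<close>

lemma dyadic_expansion_AE_covered:
  fixes f :: "real ^ 'd \<Rightarrow> real"
  assumes f: "f \<in> prediction_rules" and exp: "dyadic_expansion b f"
  shows "AE x in lebesgue_cube. \<exists>j. x \<in> dyadic_level b j"
proof -
  have "AE x in lebesgue_cube. (\<lambda>j. \<Sum>k\<in>dyadic_index j. b j k * \<phi> j k x) sums f x"
    using exp by (simp add: dyadic_expansion_def)
  thus ?thesis
  proof (rule AE_mp, intro AE_I2 impI)
    fix x assume x: "x \<in> space lebesgue_cube"
      and sums: "(\<lambda>j. \<Sum>k\<in>dyadic_index j. b j k * \<phi> j k x) sums f x"
    have "f x \<noteq> 0" using measurable_space[OF f[unfolded prediction_rules_def] x] by auto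
    show "\<exists>j. x \<in> dyadic_level b j"
    proof (rule ccontr)
      assume "\<nexists>j. x \<in> dyadic_level b j"
      hence "(\<Sum>k\<in>dyadic_index j. b j k * \<phi> j k x) = 0" for j
        by (intro sum.neutral) (auto simp: dyadic_level_def indicator_def)
      with sums have "f x = 0" using sums_unique2[of "\<lambda>_. 0" "f x" 0] by simp
      with \<open>f x \<noteq> 0\<close> show False ..
    qed
  qed
qed

lemma emeasure_dyadic_level_le:
  fixes b :: "nat \<Rightarrow> nat ^ 'd \<Rightarrow> real"
  assumes "real (card {k \<in> dyadic_index j. b j k \<noteq> 0}) \<le> w j"
  shows "emeasure lebesgue_cube (dyadic_level b j) \<le> ennreal (weight CARD('d) w j)"
proof -
  let ?K = "{k \<in> dyadic_index j. b j k \<noteq> 0}"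
  have "emeasure lebesgue_cube (dyadic_level b j) \<le> (\<Sum>k\<in>?K. emeasure lebesgue_cube (dyadic_cell j k))"
    unfolding dyadic_level_def by (intro emeasure_subadditive_finite) (auto intro: sets_dyadic_cell)
  also have "\<dots> = (\<Sum>k\<in>?K. ennreal (1 / 2 ^ (CARD('d) * j)))"
    by (intro sum.cong) (auto simp: emeasure_dyadic_cell)
  also have "\<dots> = ennreal (\<Sum>k\<in>?K. 1 / 2 ^ (CARD('d) * j))"
    by (intro sum_ennreal) auto
  also have "\<dots> \<le> ennreal (weight CARD('d) w j)"
  proof (rule ennreal_leI)
    \<comment> \<open>The floor in \<open>weight\<close> costs nothing, since a cardinality is an
      integer.\<close>
    have "int (card ?K) \<le> \<lfloor>w j\<rfloor>" using assms by (simp add: le_floor_iff)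
    hence "real (card ?K) \<le> of_int \<lfloor>w j\<rfloor>" by linarith
    thus "(\<Sum>k\<in>?K. 1 / 2 ^ (CARD('d) * j)) \<le> weight CARD('d) w j"
      by (simp add: weight_def divide_right_mono)
  qed
  finally show ?thesis .
qed

text \<open>Cells with nonzero coefficient of frequency at most \<open>J\<close> are refined to the
  common frequency \<open>J\<close>, at which the estimator is constant on cells.
  \<open>\<sigma>\<close> is the coefficient inherited from an ancestor.\<close>

lemma dyadic_class_approximation:
  fixes f :: "real ^ 'd \<Rightarrow> real"
  assumes f: "f \<in> dyadic_class w" and sum: "summable (weight CARD('d) w)"
  obtains G \<sigma> where "G \<subseteq> dyadic_index J" "\<And>k. k \<in> G \<Longrightarrow> \<sigma> k \<in> {-1, 1}"
    "\<And>k. k \<in> G \<Longrightarrow> AE x in lebesgue_cube. x \<in> dyadic_cell J k \<longrightarrow> f x = \<sigma> k"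
    "emeasure lebesgue_cube (unit_cube - (\<Union>k\<in>G. dyadic_cell J k))
       \<le> ennreal (\<Sum>i. weight CARD('d) w (i + (J + 1)))"
proof -
  obtain b where fp: "f \<in> prediction_rules" and exp: "dyadic_expansion b f"
    and wc: "writing_convention b f"
    and card: "\<And>j. real (card {k \<in> dyadic_index j. b j k \<noteq> 0}) \<le> w j"
    using f by (auto simp: dyadic_class_def)
  \<comment> \<open>\<open>P k jk\<close> says that the frequency-index pair \<open>jk\<close> is an
    ancestor of \<open>k\<close>, possibly \<open>k\<close> itself, with nonzero coefficient. Any
    such ancestor may serve as \<open>par k\<close>.\<close>
  define P where "P k jk \<longleftrightarrow> fst jk \<le> J \<and> snd jk \<in> dyadic_index (fst jk) \<and> b (fst jk) (snd jk) \<noteq> 0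
    \<and> dyadic_cell J k \<subseteq> dyadic_cell (fst jk) (snd jk)" for k and jk :: "nat \<times> (nat ^ 'd)"
  define G where "G = {k \<in> dyadic_index J. \<exists>jk. P k jk}"
  define par where "par k = (SOME jk. P k jk)" for k
  have par: "P k (par k)" if "k \<in> G" for k
    using that unfolding G_def par_def by (auto intro: someI)
  show ?thesis
  proof (rule that[of G "\<lambda>k. b (fst (par k)) (snd (par k))"])
    show "G \<subseteq> dyadic_index J" by (auto simp: G_def)
    show "b (fst (par k)) (snd (par k)) \<in> {-1, 1}" if "k \<in> G" for k
      using par[OF that] exp by (auto simp: P_def dyadic_expansion_def)
    show "AE x in lebesgue_cube. x \<in> dyadic_cell J k \<longrightarrow> f x = b (fst (par k)) (snd (par k))"
      if "k \<in> G" for k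
    proof -
      have "AE x in lebesgue_cube. x \<in> dyadic_cell (fst (par k)) (snd (par k)) \<longrightarrow>
          f x = b (fst (par k)) (snd (par k))"
        using par[OF that] by (intro dyadic_expansion_AE_constant[OF exp wc]) (auto simp: P_def)
      thus ?thesis by eventually_elim (use par[OF that] in \<open>auto simp: P_def\<close>)
    qed
    \<comment> \<open>If such a point had a nonzero cell of frequency at most \<open>J\<close>, its
      frequency-\<open>J\<close> cell would be nested in that cell and hence belong to
      \<open>G\<close>.\<close>
    have uncovered: "x \<in> (\<Union>i. dyadic_level b (i + (J + 1)))"
      if x: "x \<in> unit_cube" "x \<notin> (\<Union>k\<in>G. dyadic_cell J k)" "x \<in> dyadic_level b j" for x j
    proof (cases "j \<le> J")
      case True
      obtain k' where k': "k' \<in> dyadic_index j" "b j k' \<noteq> 0" "x \<in> dyadic_cell j k'"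
        using x by (auto simp: dyadic_level_def)
      obtain k where k: "k \<in> dyadic_index J" "x \<in> dyadic_cell J k"
        using dyadic_cell_cover[OF x(1)] by blast
      have "P k (j, k')"
        using True k k' dyadic_cell_nested[of j J k' k x] by (auto simp: P_def)
      thus ?thesis using k x(2) by (auto simp: G_def)
    next
      case False
      thus ?thesis using x(3) by (auto intro!: exI[of _ "j - (J + 1)"])
    qed
    have "emeasure lebesgue_cube (unit_cube - (\<Union>k\<in>G. dyadic_cell J k))
        \<le> emeasure lebesgue_cube (\<Union>i. dyadic_level b (i + (J + 1)))"
    proof (rule emeasure_mono_AE)
      show "AE x in lebesgue_cube. x \<in> unit_cube - (\<Union>k\<in>G. dyadic_cell J k) \<longrightarrow>
          x \<in> (\<Union>i. dyadic_level b (i + (J + 1)))"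
        using dyadic_expansion_AE_covered[OF fp exp]
        by eventually_elim (use uncovered in blast)
    qed auto
    also have "\<dots> \<le> (\<Sum>i. emeasure lebesgue_cube (dyadic_level b (i + (J + 1))))"
      by (rule emeasure_subadditive_countably) auto
    also have "\<dots> \<le> (\<Sum>i. ennreal (weight CARD('d) w (i + (J + 1))))"
      by (intro suminf_le emeasure_dyadic_level_le card) auto
    also have "\<dots> = ennreal (\<Sum>i. weight CARD('d) w (i + (J + 1)))"
    proof (rule suminf_ennreal2)
      have "0 \<le> w j" for j using card[of j] by (rule order_trans[rotated]) simp
      thus "0 \<le> weight CARD('d) w (i + (J + 1))" for i by (simp add: weight_def)
      show "summable (\<lambda>i. weight CARD('d) w (i + (J + 1)))"
        using sum by (subst summable_iff_shift)
    qed
    finally show "emeasure lebesgue_cube (unit_cube - (\<Union>k\<in>G. dyadic_cell J k))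
      \<le> ennreal (\<Sum>i. weight CARD('d) w (i + (J + 1)))" .
  qed
qed

section \<open>Risk and margin\<close>

lemma measurable_prediction_rule:
  "f \<in> prediction_rules \<Longrightarrow> f \<in> borel_measurable lebesgue_cube"
  unfolding prediction_rules_def by (rule measurable_compose[of _ _ "count_space {-1, 1}" "\<lambda>y. y"]) auto

lemma prediction_rule_values:
  "f \<in> prediction_rules \<Longrightarrow> x \<in> unit_cube \<Longrightarrow> f x = -1 \<or> f x = 1"
  using measurable_space[of f lebesgue_cube "count_space {-1, 1}" x] by (auto simp: prediction_rules_def)

text \<open>The Borel sets restricted to \<open>{-1, 1}\<close> form the discrete sigma-algebra,
  because finite sets are closed.\<close>

lemma prediction_ruleI:
  fixes f :: "real ^ 'd \<Rightarrow> real"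
  assumes f: "f \<in> borel_measurable lebesgue_cube" "\<And>x. x \<in> unit_cube \<Longrightarrow> f x = -1 \<or> f x = 1"
  shows "f \<in> prediction_rules"
proof -
  have "f \<in> lebesgue_cube \<rightarrow>\<^sub>M restrict_space borel {-1, 1}"
    using f by (intro measurable_restrict_space2) auto
  moreover have "sets (restrict_space borel {-1, 1 :: real}) = sets (count_space {-1, 1})"
    by (auto simp: sets_restrict_space_iff intro!: borel_closed finite_imp_closed
        intro: finite_subset[of _ "{-1, 1}"])
  ultimately show ?thesis
    unfolding prediction_rules_def using measurable_cong_sets[OF refl] by blast
qed

text \<open>Equality of the sigma-algebras also fixes the underlying space, so every label is
  exactly -1 or 1, not merely almost surely.\<close>

locale classification = prob_space \<pi> for \<pi> :: "((real ^ 'd) \<times> real) measure" +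
  assumes sets_eq: "sets \<pi> = sets sample_space"
begin

lemma space_eq: "space \<pi> = unit_cube \<times> {-1, 1}"
  using sets_eq_imp_space_eq[OF sets_eq] by (simp add: sample_space_def space_pair_measure)

lemma measurable_X [measurable]: "fst \<in> \<pi> \<rightarrow>\<^sub>M lebesgue_cube"
  unfolding measurable_cong_sets[OF sets_eq refl] sample_space_def by simp

lemma measurable_Y [measurable]: "snd \<in> borel_measurable \<pi>"
proof -
  have "snd \<in> \<pi> \<rightarrow>\<^sub>M count_space {-1, 1}"
    unfolding measurable_cong_sets[OF sets_eq refl] sample_space_def by simp
  moreover have "(\<lambda>y. y) \<in> count_space {-1, 1} \<rightarrow>\<^sub>M (borel :: real measure)" by simp
  ultimately show ?thesis by (rule measurable_compose)
qed

lemma prob_X_split: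
  assumes [measurable]: "S \<in> sets lebesgue_cube"
  shows "prob {z \<in> space \<pi>. fst z \<in> S} =
    prob {z \<in> space \<pi>. fst z \<in> S \<and> snd z = 1} + prob {z \<in> space \<pi>. fst z \<in> S \<and> snd z = -1}"
proof -
  have "{z \<in> space \<pi>. fst z \<in> S} =
      {z \<in> space \<pi>. fst z \<in> S \<and> snd z = 1} \<union> {z \<in> space \<pi>. fst z \<in> S \<and> snd z = -1}"
    by (auto simp: space_eq)
  thus ?thesis by (simp only:) (rule finite_measure_Union; auto)
qed

text \<open>Where \<open>f\<close> errs, either \<open>g\<close> errs too or the two rules
  disagree.\<close>

lemma risk_le_diff:
  assumes f: "f \<in> prediction_rules" and g: "g \<in> prediction_rules"
  shows "risk \<pi> f - risk \<pi> g \<le> prob {z \<in> space \<pi>. f (fst z) \<noteq> g (fst z)}"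
proof -
  note [measurable] = measurable_prediction_rule[OF f] measurable_prediction_rule[OF g]
  have "risk \<pi> f \<le> prob ({z \<in> space \<pi>. g (fst z) \<noteq> snd z} \<union> {z \<in> space \<pi>. f (fst z) \<noteq> g (fst z)})"
    unfolding risk_def by (intro finite_measure_mono) auto
  also have "\<dots> \<le> risk \<pi> g + prob {z \<in> space \<pi>. f (fst z) \<noteq> g (fst z)}"
    unfolding risk_def by (intro measure_Un_le) auto
  finally show ?thesis by simp
qed

lemma bayes_rule_prediction_rule:
  assumes "regression_function \<pi> \<eta>"
  shows "bayes_rule \<eta> \<in> prediction_rules"
proof (rule prediction_ruleI)
  have [measurable]: "\<eta> \<in> borel_measurable lebesgue_cube"
    using assms by (simp add: regression_function_def)
  show "bayes_rule \<eta> \<in> borel_measurable lebesgue_cube"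
    unfolding bayes_rule_def[abs_def] by measurable
qed (auto simp: bayes_rule_def)

text \<open>The event that \<open>X\<close> lies in \<open>S\<close> belongs to the sigma-algebra
  generated by \<open>X\<close>, so the conditional expectation can be integrated over it. This
  converts statements on \<open>\<eta>\<close> into statements on label probabilities.\<close>

lemma regression_function_integral:
  assumes \<eta>: "regression_function \<pi> \<eta>" and S [measurable]: "S \<in> sets lebesgue_cube"
  shows "integrable \<pi> (\<lambda>z. indicator S (fst z) * (2 * \<eta> (fst z) - 1))"
    and "(\<integral>z. indicator S (fst z) * (2 * \<eta> (fst z) - 1) \<partial>\<pi>) =
      prob {z \<in> space \<pi>. fst z \<in> S \<and> snd z = 1} - prob {z \<in> space \<pi>. fst z \<in> S \<and> snd z = -1}"
proof -
  define F where "F = vimage_algebra (space \<pi>) fst lebesgue_cube"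
  define g :: "(real ^ 'd) \<times> real \<Rightarrow> real" where "g = indicator {z. snd z = 1}"
  have F: "sets F = {fst -` B \<inter> space \<pi> |B. B \<in> sets lebesgue_cube}"
    unfolding F_def by (rule sets_vimage_algebra2) (auto simp: space_eq)
  have "subalgebra \<pi> F"
    unfolding subalgebra_def F by (auto simp: F_def intro: measurable_sets)
  then interpret F: finite_measure_subalgebra \<pi> F by unfold_locales
  have [measurable]: "\<eta> \<in> borel_measurable lebesgue_cube"
    and AE: "AE z in \<pi>. \<eta> (fst z) = real_cond_exp \<pi> F g z"
    using \<eta> by (simp_all add: regression_function_def F_def g_def)
  have [measurable]: "g \<in> borel_measurable \<pi>"
    unfolding g_def by (intro borel_measurable_indicator') auto
  have g_int: "integrable \<pi> g"
    by (rule integrable_const_bound[of _ 1]) (auto simp: g_def indicator_def)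
  \<comment> \<open>Integrability comes from the almost sure agreement with the conditional
    expectation of a bounded function.\<close>
  have \<eta>_int: "integrable \<pi> (\<lambda>z. \<eta> (fst z))"
    using F.real_cond_exp_int(1)[OF g_int] by (subst integrable_cong_AE[OF _ _ AE]) auto
  define T where "T = {z \<in> space \<pi>. fst z \<in> S}"
  have T: "T \<in> sets F" unfolding F T_def using S by auto
  have [measurable]: "T \<in> sets \<pi>" unfolding T_def by measurable
  have int: "integrable \<pi> (\<lambda>z. indicator T z * \<eta> (fst z))"
    using integrable_mult_indicator[OF _ \<eta>_int, of T] by simp
  have eq: "indicator S (fst z) * (2 * \<eta> (fst z) - 1) = 2 * (indicator T z * \<eta> (fst z)) - indicator T z"
    if "z \<in> space \<pi>" for z
    using that by (auto simp: T_def indicator_def)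
  show "integrable \<pi> (\<lambda>z. indicator S (fst z) * (2 * \<eta> (fst z) - 1))"
    using int by (subst Bochner_Integration.integrable_cong[OF refl eq])
      (auto intro!: Bochner_Integration.integrable_diff simp: emeasure_eq_measure)
  have "(\<integral>z. indicator S (fst z) * (2 * \<eta> (fst z) - 1) \<partial>\<pi>) =
      2 * (\<integral>z. indicator T z * \<eta> (fst z) \<partial>\<pi>) - prob T"
    using int by (subst Bochner_Integration.integral_cong[OF refl eq]) (auto simp: emeasure_eq_measure)
  also have "(\<integral>z. indicator T z * \<eta> (fst z) \<partial>\<pi>) = (\<integral>z\<in>T. real_cond_exp \<pi> F g z \<partial>\<pi>)"
    unfolding set_lebesgue_integral_def using AE by (intro integral_cong_AE) auto
  \<comment> \<open>The defining property of conditional expectation.\<close>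
  also have "\<dots> = (\<integral>z\<in>T. g z \<partial>\<pi>)"
    by (rule F.real_cond_exp_intA[symmetric, OF g_int T])
  also have "\<dots> = (\<integral>z. indicator {z \<in> space \<pi>. fst z \<in> S \<and> snd z = 1} z \<partial>\<pi>)"
    unfolding set_lebesgue_integral_def
    by (intro Bochner_Integration.integral_cong) (auto simp: T_def g_def indicator_def)
  also have "\<dots> = prob {z \<in> space \<pi>. fst z \<in> S \<and> snd z = 1}" by simp
  finally show "(\<integral>z. indicator S (fst z) * (2 * \<eta> (fst z) - 1) \<partial>\<pi>) =
      prob {z \<in> space \<pi>. fst z \<in> S \<and> snd z = 1} - prob {z \<in> space \<pi>. fst z \<in> S \<and> snd z = -1}"
    using prob_X_split[OF S] by (simp add: T_def)
qed

text \<open>Where the Bayes rule equals \<open>s\<close>, \<open>s * (2 * \<eta> - 1)\<close> is the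
  absolute value of \<open>2 * \<eta> - 1\<close>, and integrating it over \<open>S\<close> gives
  the gap between the two labels. The lemma serves with \<open>h = 0\<close> for optimality and with
  the true margin on cells.\<close>

lemma margin:
  assumes \<eta>: "regression_function \<pi> \<eta>" and S [measurable]: "S \<in> sets lebesgue_cube"
    and h: "AE z in \<pi>. fst z \<in> S \<longrightarrow> h \<le> \<bar>2 * \<eta> (fst z) - 1\<bar>"
    and s: "s \<in> {-1, 1}" "AE z in \<pi>. fst z \<in> S \<longrightarrow> bayes_rule \<eta> (fst z) = s"
  shows "h * prob {z \<in> space \<pi>. fst z \<in> S} \<le>
    prob {z \<in> space \<pi>. fst z \<in> S \<and> snd z = s} - prob {z \<in> space \<pi>. fst z \<in> S \<and> snd z = -s}"
proof -
  have "h * prob {z \<in> space \<pi>. fst z \<in> S} = (\<integral>z. h * indicator {z \<in> space \<pi>. fst z \<in> S} z \<partial>\<pi>)"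
    by simp
  also have "\<dots> \<le> (\<integral>z. s * (indicator S (fst z) * (2 * \<eta> (fst z) - 1)) \<partial>\<pi>)"
  proof (rule integral_mono_AE)
    show "integrable \<pi> (\<lambda>z. h * indicator {z \<in> space \<pi>. fst z \<in> S} z)"
      by (auto simp: emeasure_eq_measure)
    show "integrable \<pi> (\<lambda>z. s * (indicator S (fst z) * (2 * \<eta> (fst z) - 1)))"
      using regression_function_integral(1)[OF \<eta> S] by simp
    show "AE z in \<pi>. h * indicator {z \<in> space \<pi>. fst z \<in> S} z
        \<le> s * (indicator S (fst z) * (2 * \<eta> (fst z) - 1))"
      using h s(2)
      by eventually_elim (auto simp: indicator_def bayes_rule_def abs_if split: if_splits)
  qed
  also have "\<dots> = s * (prob {z \<in> space \<pi>. fst z \<in> S \<and> snd z = 1}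
      - prob {z \<in> space \<pi>. fst z \<in> S \<and> snd z = -1})"
    using regression_function_integral(2)[OF \<eta> S] by simp
  also have "\<dots> = prob {z \<in> space \<pi>. fst z \<in> S \<and> snd z = s} - prob {z \<in> space \<pi>. fst z \<in> S \<and> snd z = -s}"
    using s(1) by auto
  finally show ?thesis .
qed

text \<open>Where the rules disagree, \<open>f\<close> errs exactly when the label is the value of
  \<open>g\<close>. The agreement term is common to both risks and cancels when they are
  compared.\<close>

lemma risk_split:
  fixes f g :: "real ^ 'd \<Rightarrow> real"
  assumes f: "f \<in> prediction_rules" and g: "g \<in> prediction_rules"
  defines "S \<equiv> \<lambda>s. {x \<in> unit_cube. f x = -s \<and> g x = s}"
  shows "risk \<pi> f = prob {z \<in> space \<pi>. f (fst z) = g (fst z) \<and> g (fst z) \<noteq> snd z} +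
    prob {z \<in> space \<pi>. fst z \<in> S 1 \<and> snd z = 1} + prob {z \<in> space \<pi>. fst z \<in> S (-1) \<and> snd z = -1}"
proof -
  note [measurable] = measurable_prediction_rule[OF f] measurable_prediction_rule[OF g]
  note vals = prediction_rule_values[OF f] prediction_rule_values[OF g]
  let ?A = "{z \<in> space \<pi>. f (fst z) = g (fst z) \<and> g (fst z) \<noteq> snd z}"
  let ?B = "\<lambda>s. {z \<in> space \<pi>. fst z \<in> S s \<and> snd z = s}"
  have [measurable]: "S s \<in> sets lebesgue_cube" for s
    unfolding S_def space_lebesgue_cube[symmetric] by measurable
  have "{z \<in> space \<pi>. f (fst z) \<noteq> snd z} = ?A \<union> ?B 1 \<union> ?B (-1)"
    using vals by (fastforce simp: space_eq S_def)
  hence "risk \<pi> f = prob (?A \<union> ?B 1 \<union> ?B (-1))" by (simp only: risk_def)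
  also have "\<dots> = prob (?A \<union> ?B 1) + prob (?B (-1))"
    by (rule finite_measure_Union, measurable) (auto simp: S_def)
  also have "prob (?A \<union> ?B 1) = prob ?A + prob (?B 1)"
    by (rule finite_measure_Union, measurable) (auto simp: S_def)
  finally show ?thesis .
qed

lemma bayes_rule_optimal:
  assumes \<eta>: "regression_function \<pi> \<eta>" and f: "f \<in> prediction_rules"
  shows "risk \<pi> (bayes_rule \<eta>) \<le> risk \<pi> f"
proof -
  define g where "g = bayes_rule \<eta>"
  have g: "g \<in> prediction_rules" unfolding g_def by (rule bayes_rule_prediction_rule[OF \<eta>])
  note [measurable] = measurable_prediction_rule[OF f] measurable_prediction_rule[OF g]
  define S where "S s = {x \<in> unit_cube. f x = -s \<and> g x = s}" for s
  have [measurable]: "S s \<in> sets lebesgue_cube" for s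
    unfolding S_def space_lebesgue_cube[symmetric] by measurable
  have le: "prob {z \<in> space \<pi>. fst z \<in> S s \<and> snd z = -s} \<le> prob {z \<in> space \<pi>. fst z \<in> S s \<and> snd z = s}"
    if "s \<in> {-1, 1}" for s
  proof -
    \<comment> \<open>This is \<open>margin\<close> with \<open>h = 0\<close>, for which the lower
      bound on the absolute value is trivial.\<close>
    have "0 * prob {z \<in> space \<pi>. fst z \<in> S s} \<le>
        prob {z \<in> space \<pi>. fst z \<in> S s \<and> snd z = s} - prob {z \<in> space \<pi>. fst z \<in> S s \<and> snd z = -s}"
      using that by (intro margin[OF \<eta>], measurable) (auto simp: S_def g_def)
    thus ?thesis by simp
  qed
  have "risk \<pi> f = prob {z \<in> space \<pi>. f (fst z) = g (fst z) \<and> g (fst z) \<noteq> snd z} +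
      prob {z \<in> space \<pi>. fst z \<in> S 1 \<and> snd z = 1} + prob {z \<in> space \<pi>. fst z \<in> S (-1) \<and> snd z = -1}"
    using risk_split[OF f g] by (simp add: S_def)
  \<comment> \<open>Exchanging the two rules turns \<open>S s\<close> into \<open>S (-s)\<close>,
    which swaps the labels in the disagreement terms.\<close>
  moreover have "risk \<pi> g = prob {z \<in> space \<pi>. f (fst z) = g (fst z) \<and> g (fst z) \<noteq> snd z} +
      prob {z \<in> space \<pi>. fst z \<in> S (-1) \<and> snd z = 1} + prob {z \<in> space \<pi>. fst z \<in> S 1 \<and> snd z = -1}"
  proof -
    have "{z \<in> space \<pi>. g (fst z) = f (fst z) \<and> f (fst z) \<noteq> snd z} =
        {z \<in> space \<pi>. f (fst z) = g (fst z) \<and> g (fst z) \<noteq> snd z}" by auto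
    thus ?thesis using risk_split[OF g f] by (simp add: S_def conj_commute)
  qed
  ultimately show ?thesis using le[of 1] le[of "-1"] by (simp add: g_def)
qed

lemma bayes_risk_eq:
  assumes \<eta>: "regression_function \<pi> \<eta>"
  shows "bayes_risk \<pi> = risk \<pi> (bayes_rule \<eta>)"
  unfolding bayes_risk_def
  by (intro cInf_eq_minimum imageI bayes_rule_prediction_rule[OF \<eta>])
    (auto intro: bayes_rule_optimal[OF \<eta>])

end

section \<open>Deviation of the majority vote\<close>

text \<open>The left side is the expectation of \<open>exp (- h * Z)\<close> for a sign
  \<open>Z\<close> equal to 1 with probability \<open>(1 + h) / 2\<close>. Since \<open>Z\<close>
  has mean \<open>h\<close> and range of length 2, Hoeffding's lemma bounds it by
  \<open>exp (- h * h + h\<^sup>2 / 2)\<close>.\<close>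

lemma exp_margin_le:
  fixes h :: real
  assumes "0 \<le> h" "h \<le> 1"
  shows "(1 + h) / 2 * exp (- h) + (1 - h) / 2 * exp h \<le> exp (- h\<^sup>2 / 2)"
proof -
  define p where "p = (1 - h) / 2"
  have p: "0 \<le> p" using assms by (simp add: p_def)
  have pos: "0 < 1 + p * (exp (2 * h) - 1)"
    using p assms by (intro add_pos_nonneg mult_nonneg_nonneg) auto
  \<comment> \<open>The auxiliary inequality concerns a variable on 0 and \<open>2 * h\<close> with
    weight \<open>p\<close> at \<open>2 * h\<close>. The factor \<open>exp (- h)\<close> introduced
    below shifts it to \<open>-h\<close> and \<open>h\<close>.\<close>
  have "-(2 * h) * p + ln (1 + p * (exp (2 * h) - 1)) \<le> (2 * h)\<^sup>2 / 8"
    using assms p by (intro Hoeffdings_lemma_aux) auto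
  hence "ln (1 + p * (exp (2 * h) - 1)) \<le> h - h\<^sup>2 / 2"
    by (simp add: p_def field_simps power2_eq_square)
  hence "1 + p * (exp (2 * h) - 1) \<le> exp (h - h\<^sup>2 / 2)"
    using pos by (metis exp_le_cancel_iff exp_ln)
  hence "exp (- h) * (1 + p * (exp (2 * h) - 1)) \<le> exp (- h) * exp (h - h\<^sup>2 / 2)"
    by (intro mult_left_mono) auto
  moreover have "exp (- h) * (1 + p * (exp (2 * h) - 1)) = (1 + h) / 2 * exp (- h) + (1 - h) / 2 * exp h"
  proof -
    have "exp (- h) * exp (2 * h) = exp h" by (simp flip: exp_add)
    thus ?thesis by (simp add: p_def algebra_simps diff_divide_distrib add_divide_distrib)
  qed
  ultimately show ?thesis by (simp flip: exp_add)
qed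

text \<open>Ties and empty cells count as errors when \<open>s = 1\<close>; the bound \<open>1 \<le> \<dots>\<close> covers them since the
  signed vote is then nonpositive.\<close>

lemma estimator_coeff_error:
  fixes D :: "nat \<Rightarrow> (real ^ 'd) \<times> real"
  assumes D: "\<And>i. i \<in> {1..n} \<Longrightarrow> snd (D i) \<in> {-1, 1}"
    and s: "s \<in> {-1, 1}" and h: "0 \<le> h"
    and ne: "estimator_coeff n J D k \<noteq> s"
  shows "1 \<le> (\<Prod>i\<in>{1..n}. exp (- h * (\<phi> J k (fst (D i)) * (s * snd (D i)))))"
proof -
  define N where "N y = card {i \<in> {1..n}. fst (D i) \<in> dyadic_cell J k \<and> snd (D i) = y}" for y
  have coeff: "estimator_coeff n J D k =
      (if (\<exists>i\<in>{1..n}. fst (D i) \<in> dyadic_cell J k) \<and> N (-1) < N 1 then 1 else -1)"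
    by (simp add: estimator_coeff_def N_def)
  have "(\<Sum>i\<in>{1..n}. \<phi> J k (fst (D i)) * (s * snd (D i))) =
      (\<Sum>i\<in>{1..n}. s * (of_bool (fst (D i) \<in> dyadic_cell J k \<and> snd (D i) = 1)
        - of_bool (fst (D i) \<in> dyadic_cell J k \<and> snd (D i) = -1)))"
    using D by (intro sum.cong) (auto simp: indicator_def)
  also have "\<dots> = s * (real (N 1) - real (N (-1)))"
    unfolding sum_distrib_left[symmetric] sum_subtractf
    by (simp add: N_def sum_of_bool_eq Int_def)
  also have "\<dots> \<le> 0"
  proof (cases "s = 1")
    case True
    \<comment> \<open>A strict majority supplies a data point in the cell, so a coefficient other
      than 1 can only mean that label 1 has no strict majority.\<close>
    have "\<exists>i\<in>{1..n}. fst (D i) \<in> dyadic_cell J k" if "N 1 > N (-1)"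
    proof -
      have "0 < N 1" using that by linarith
      thus ?thesis by (auto simp: N_def card_gt_0_iff)
    qed
    hence "N 1 \<le> N (-1)"
      using ne True unfolding coeff by (cases "N (-1) < N 1") auto
    thus ?thesis using True by simp
  next
    case False
    hence "s = -1" using s by auto
    thus ?thesis using ne by (auto simp: coeff split: if_splits)
  qed
  finally have "0 \<le> - h * (\<Sum>i\<in>{1..n}. \<phi> J k (fst (D i)) * (s * snd (D i)))"
    using h by (simp add: mult_nonneg_nonpos)
  thus ?thesis by (simp flip: exp_sum add: sum_distrib_left[symmetric] sum_negf)
qed

context classification
begin

text \<open>The exponential moment of one signed vote is largest when the margin is attained, that
  is, when the label is \<open>s\<close> with conditional probability \<open>(1 + h) / 2\<close> on
  \<open>S\<close>; this extreme case is \<open>exp_margin_le\<close>.\<close>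

lemma margin_mgf:
  assumes S [measurable]: "S \<in> sets lebesgue_cube" and s: "s \<in> {-1, 1}" and h: "0 \<le> h" "h \<le> 1"
    and margin: "h * prob {z \<in> space \<pi>. fst z \<in> S} \<le>
      prob {z \<in> space \<pi>. fst z \<in> S \<and> snd z = s} - prob {z \<in> space \<pi>. fst z \<in> S \<and> snd z = -s}"
  shows "integrable \<pi> (\<lambda>z. exp (- h * (indicator S (fst z) * (s * snd z))))"
    and "(\<integral>z. exp (- h * (indicator S (fst z) * (s * snd z))) \<partial>\<pi>) \<le>
      1 - prob {z \<in> space \<pi>. fst z \<in> S} * (1 - exp (- h\<^sup>2 / 2))"
proof -
  define T where "T = {z \<in> space \<pi>. fst z \<in> S}"
  define U where "U y = {z \<in> space \<pi>. fst z \<in> S \<and> snd z = y}" for y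
  have [measurable]: "T \<in> sets \<pi>" "U y \<in> sets \<pi>" for y
    unfolding T_def U_def by measurable
  have eq: "exp (- h * (indicator S (fst z) * (s * snd z))) =
      1 - indicator T z + exp (- h) * indicator (U s) z + exp h * indicator (U (-s)) z"
    if "z \<in> space \<pi>" for z
    using that s by (auto simp: T_def U_def indicator_def space_eq)
  have int: "integrable \<pi> (indicator B :: _ \<Rightarrow> real)" if "B \<in> sets \<pi>" for B
    using that by (simp add: emeasure_eq_measure)
  show "integrable \<pi> (\<lambda>z. exp (- h * (indicator S (fst z) * (s * snd z))))"
    by (subst Bochner_Integration.integrable_cong[OF refl eq])
      (auto intro!: Bochner_Integration.integrable_add Bochner_Integration.integrable_diff
        integrable_mult_right int)
  have q: "prob T = prob (U s) + prob (U (-s))"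
    using prob_X_split[OF S] s unfolding T_def U_def by auto
  have "(\<integral>z. exp (- h * (indicator S (fst z) * (s * snd z))) \<partial>\<pi>) =
      1 - prob T + exp (- h) * prob (U s) + exp h * prob (U (-s))"
    by (subst Bochner_Integration.integral_cong[OF refl eq]) (auto simp: int prob_space)
  \<comment> \<open>Eliminating \<open>U (-s)\<close> leaves \<open>prob (U s)\<close> with a
    nonpositive coefficient, so its lower bound from the margin can be inserted.\<close>
  also have "\<dots> = 1 - prob T + (exp h * prob T - (exp h - exp (- h)) * prob (U s))"
    by (simp add: q algebra_simps)
  also have "\<dots> \<le> 1 - prob T + (exp h * prob T - (exp h - exp (- h)) * ((1 + h) / 2 * prob T))"
  proof -
    have "(1 + h) / 2 * prob T \<le> prob (U s)"
      using margin unfolding T_def[symmetric] U_def[symmetric] by (simp add: q field_simps)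
    thus ?thesis using h by (intro add_left_mono diff_left_mono mult_left_mono) auto
  qed
  also have "\<dots> = 1 - prob T + prob T * ((1 + h) / 2 * exp (- h) + (1 - h) / 2 * exp h)"
    by (simp add: field_simps)
  also have "\<dots> \<le> 1 - prob T + prob T * exp (- h\<^sup>2 / 2)"
    by (intro add_left_mono mult_left_mono exp_margin_le h) auto
  finally show "(\<integral>z. exp (- h * (indicator S (fst z) * (s * snd z))) \<partial>\<pi>) \<le>
      1 - prob {z \<in> space \<pi>. fst z \<in> S} * (1 - exp (- h\<^sup>2 / 2))"
    by (simp add: T_def algebra_simps)
qed

text \<open>Independence makes the integral of the product an \<open>n\<close>-th power, and
  \<open>1 - x \<le> exp (- x)\<close> turns the power into an exponential.\<close>

lemma data_law_margin_mgf:
  assumes S: "S \<in> sets lebesgue_cube" and s: "s \<in> {-1, 1}" and h: "0 \<le> h" "h \<le> 1"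
    and margin: "h * prob {z \<in> space \<pi>. fst z \<in> S} \<le>
      prob {z \<in> space \<pi>. fst z \<in> S \<and> snd z = s} - prob {z \<in> space \<pi>. fst z \<in> S \<and> snd z = -s}"
  defines "L \<equiv> \<lambda>z. exp (- h * (indicator S (fst z) * (s * snd z)))"
  shows "integrable (data_law \<pi> n) (\<lambda>D. \<Prod>i\<in>{1..n}. L (D i))"
    and "(\<integral>D. (\<Prod>i\<in>{1..n}. L (D i)) \<partial>data_law \<pi> n) \<le>
      exp (- (real n * prob {z \<in> space \<pi>. fst z \<in> S} * (1 - exp (- h\<^sup>2 / 2))))"
proof -
  interpret P: product_prob_space "\<lambda>_. \<pi>" "{1..n}" by unfold_locales
  note mgf = margin_mgf[OF S s h margin, folded L_def]
  define q where "q = prob {z \<in> space \<pi>. fst z \<in> S} * (1 - exp (- h\<^sup>2 / 2))"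
  show "integrable (data_law \<pi> n) (\<lambda>D. \<Prod>i\<in>{1..n}. L (D i))"
    unfolding data_law_def by (rule P.product_integrable_prod) (use mgf(1) in auto)
  have "(\<integral>D. (\<Prod>i\<in>{1..n}. L (D i)) \<partial>data_law \<pi> n) = (\<integral>z. L z \<partial>\<pi>) ^ n"
    unfolding data_law_def by (subst P.product_integral_prod) (use mgf(1) in auto)
  also have "\<dots> \<le> exp (- q) ^ n"
  proof (rule power_mono)
    have "(\<integral>z. L z \<partial>\<pi>) \<le> 1 + (- q)" using mgf(2) by (simp add: q_def)
    also have "\<dots> \<le> exp (- q)" by (rule exp_ge_add_one_self)
    finally show "(\<integral>z. L z \<partial>\<pi>) \<le> exp (- q)" .
  qed (auto simp: L_def)
  also have "\<dots> = exp (- (real n * prob {z \<in> space \<pi>. fst z \<in> S} * (1 - exp (- h\<^sup>2 / 2))))"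
    by (simp add: q_def flip: exp_of_nat_mult)
  finally show "(\<integral>D. (\<Prod>i\<in>{1..n}. L (D i)) \<partial>data_law \<pi> n) \<le>
      exp (- (real n * prob {z \<in> space \<pi>. fst z \<in> S} * (1 - exp (- h\<^sup>2 / 2))))" .
qed

end

section \<open>Excess risk of the estimator\<close>

lemma estimator_coeff_values: "estimator_coeff n J D k \<in> {-1, 1}"
  by (simp add: estimator_coeff_def)

lemma estimator_on_cell:
  assumes "k \<in> dyadic_index J" "x \<in> dyadic_cell J k"
  shows "estimator n J D x = estimator_coeff n J D k"
proof -
  have "estimator n J D x =
      (\<Sum>k'\<in>dyadic_index J. if k' = k then estimator_coeff n J D k else 0)"
    unfolding estimator_def
    using assms by (intro sum.cong) (auto simp: indicator_def dest: dyadic_cell_inj)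
  thus ?thesis using assms(1) by simp
qed

lemma estimator_prediction_rule: 
  fixes D :: "nat \<Rightarrow> (real ^ 'd) \<times> real"
  shows "estimator n J D \<in> prediction_rules"
proof (rule prediction_ruleI)
  have "indicator (dyadic_cell J k) \<in> borel_measurable lebesgue_cube"
    if "k \<in> dyadic_index J" for k :: "nat ^ 'd"
    using sets_dyadic_cell[OF that] by (rule borel_measurable_indicator)
  thus "estimator n J D \<in> borel_measurable lebesgue_cube"
    unfolding estimator_def[abs_def] by (intro borel_measurable_sum borel_measurable_times) auto
next
  fix x :: "real ^ 'd" assume "x \<in> unit_cube"
  then obtain k where k: "k \<in> dyadic_index J" "x \<in> dyadic_cell J k"
    using dyadic_cell_cover by blast
  show "estimator n J D x = -1 \<or> estimator n J D x = 1"
    using estimator_coeff_values[of n J D k] estimator_on_cell[OF k] by auto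
qed

section \<open>The law of \<open>X\<close>, and the risk for fixed and for random data\<close>

context classification
begin

lemma sets_marginal: "sets (marginal \<pi>) = sets lebesgue_cube"
  by (simp add: marginal_def)

text \<open>Carries the Lebesgue almost everywhere facts about expansions over to almost sure facts
  about \<open>X\<close>.\<close>

lemma AE_X:
  assumes "absolutely_continuous lebesgue_cube (marginal \<pi>)" and "AE x in lebesgue_cube. P x"
  shows "AE z in \<pi>. P (fst z)"
proof -
  have "AE x in marginal \<pi>. P x"
    using absolutely_continuous_AE[of "marginal \<pi>" lebesgue_cube P] assms by (simp add: sets_marginal)
  thus ?thesis unfolding marginal_def by (rule AE_distrD[OF measurable_X])
qed

lemma emeasure_marginal:
  assumes "S \<in> sets lebesgue_cube"
  shows "emeasure (marginal \<pi>) S = ennreal (prob {z \<in> space \<pi>. fst z \<in> S})"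
proof -
  have "emeasure (marginal \<pi>) S = emeasure \<pi> (fst -` S \<inter> space \<pi>)"
    unfolding marginal_def using assms by (intro emeasure_distr) auto
  also have "fst -` S \<inter> space \<pi> = {z \<in> space \<pi>. fst z \<in> S}" by auto
  finally show ?thesis by (simp add: emeasure_eq_measure)
qed

lemma prob_X_le:
  assumes p [measurable]: "p \<in> borel_measurable lebesgue_cube"
    and marg: "marginal \<pi> = density lebesgue_cube (\<lambda>x. ennreal (p x))"
    and A: "0 \<le> A" "\<And>x. x \<in> unit_cube \<Longrightarrow> p x \<le> A"
    and S [measurable]: "S \<in> sets lebesgue_cube" and r: "0 \<le> r" "emeasure lebesgue_cube S \<le> ennreal r"
  shows "prob {z \<in> space \<pi>. fst z \<in> S} \<le> A * r"
proof -
  have "ennreal (prob {z \<in> space \<pi>. fst z \<in> S}) = (\<integral>\<^sup>+x. ennreal (p x) * indicator S x \<partial>lebesgue_cube)"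
    by (simp add: emeasure_marginal[OF S, symmetric] marg emeasure_density)
  also have "\<dots> \<le> (\<integral>\<^sup>+x. ennreal A * indicator S x \<partial>lebesgue_cube)"
    by (intro nn_integral_mono mult_right_mono ennreal_leI A) auto
  also have "\<dots> = ennreal A * emeasure lebesgue_cube S"
    by (simp add: nn_integral_cmult_indicator)
  also have "\<dots> \<le> ennreal A * ennreal r" by (intro mult_left_mono r) auto
  also have "\<dots> = ennreal (A * r)" using A r by (simp add: ennreal_mult)
  finally show ?thesis using A r by simp
qed

lemma prob_X_ge:
  assumes p [measurable]: "p \<in> borel_measurable lebesgue_cube"
    and marg: "marginal \<pi> = density lebesgue_cube (\<lambda>x. ennreal (p x))"
    and a: "0 \<le> a" "\<And>x. x \<in> unit_cube \<Longrightarrow> a \<le> p x"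
    and S [measurable]: "S \<in> sets lebesgue_cube" and r: "0 \<le> r" "ennreal r \<le> emeasure lebesgue_cube S"
  shows "a * r \<le> prob {z \<in> space \<pi>. fst z \<in> S}"
proof -
  have "ennreal (a * r) = ennreal a * ennreal r" using a r by (simp add: ennreal_mult)
  also have "\<dots> \<le> ennreal a * emeasure lebesgue_cube S" by (intro mult_left_mono r) auto
  also have "\<dots> = (\<integral>\<^sup>+x. ennreal a * indicator S x \<partial>lebesgue_cube)"
    by (simp add: nn_integral_cmult_indicator)
  also have "\<dots> \<le> (\<integral>\<^sup>+x. ennreal (p x) * indicator S x \<partial>lebesgue_cube)"
    by (intro nn_integral_mono mult_right_mono ennreal_leI a) auto
  also have "\<dots> = ennreal (prob {z \<in> space \<pi>. fst z \<in> S})"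
    by (simp add: emeasure_marginal[OF S, symmetric] marg emeasure_density)
  finally show ?thesis by simp
qed

text \<open>Here the data are fixed. On a cell of \<open>G\<close> both rules are almost surely
  constant, so disagreement there means that the vote of the whole cell is wrong.\<close>

lemma risk_estimator_le:
  fixes G :: "(nat ^ 'd) set" and g :: "real ^ 'd \<Rightarrow> real"
  assumes g: "g \<in> prediction_rules" and G: "G \<subseteq> dyadic_index J"
    and const: "\<And>k. k \<in> G \<Longrightarrow> AE z in \<pi>. fst z \<in> dyadic_cell J k \<longrightarrow> g (fst z) = \<sigma> k"
  shows "risk \<pi> (estimator n J D) - risk \<pi> g \<le>
    prob {z \<in> space \<pi>. fst z \<in> unit_cube - (\<Union>k\<in>G. dyadic_cell J k)} +
    (\<Sum>k\<in>{k \<in> G. estimator_coeff n J D k \<noteq> \<sigma> k}. prob {z \<in> space \<pi>. fst z \<in> dyadic_cell J k})"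
proof -
  let ?W = "{k \<in> G. estimator_coeff n J D k \<noteq> \<sigma> k}"
  let ?B = "{z \<in> space \<pi>. fst z \<in> unit_cube - (\<Union>k\<in>G. dyadic_cell J k)}"
  let ?C = "\<lambda>k. {z \<in> space \<pi>. fst z \<in> dyadic_cell J k}"
  have fin: "finite G" using G by (rule finite_subset) simp
  have C [measurable]: "dyadic_cell J k \<in> sets lebesgue_cube" if "k \<in> G" for k
    using that G sets_dyadic_cell by auto
  have [measurable]: "unit_cube - (\<Union>k\<in>G. dyadic_cell J k) \<in> sets lebesgue_cube"
    using fin by (subst space_lebesgue_cube[symmetric]) (intro sets.Diff sets.top sets.finite_UN C)
  have events: "?B \<in> events" "\<And>k. k \<in> G \<Longrightarrow> ?C k \<in> events" by measurable
  have "risk \<pi> (estimator n J D) - risk \<pi> g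
      \<le> prob {z \<in> space \<pi>. estimator n J D (fst z) \<noteq> g (fst z)}"
    by (rule risk_le_diff[OF estimator_prediction_rule g])
  also have "\<dots> \<le> prob (?B \<union> (\<Union>k\<in>?W. ?C k))"
  proof (rule finite_measure_mono_AE)
    have "AE z in \<pi>. \<forall>k\<in>G. fst z \<in> dyadic_cell J k \<longrightarrow> g (fst z) = \<sigma> k"
      using fin const by (simp add: AE_finite_all)
    thus "AE z in \<pi>. z \<in> {z \<in> space \<pi>. estimator n J D (fst z) \<noteq> g (fst z)} \<longrightarrow>
        z \<in> ?B \<union> (\<Union>k\<in>?W. ?C k)"
    proof (eventually_elim, intro impI)
      fix z assume z: "\<forall>k\<in>G. fst z \<in> dyadic_cell J k \<longrightarrow> g (fst z) = \<sigma> k"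
        and ne: "z \<in> {z \<in> space \<pi>. estimator n J D (fst z) \<noteq> g (fst z)}"
      have "fst z \<in> unit_cube" using ne by (auto simp: space_eq)
      show "z \<in> ?B \<union> (\<Union>k\<in>?W. ?C k)"
      proof (cases "\<exists>k\<in>G. fst z \<in> dyadic_cell J k")
        case True
        then obtain k where k: "k \<in> G" "fst z \<in> dyadic_cell J k" by blast
        hence "estimator_coeff n J D k \<noteq> \<sigma> k"
          using z ne G estimator_on_cell[of k J "fst z" n D] by auto
        thus ?thesis using k ne by auto
      next
        case False
        thus ?thesis using ne \<open>fst z \<in> unit_cube\<close> by auto
      qed
    qed
    show "?B \<union> (\<Union>k\<in>?W. ?C k) \<in> events"
      using fin events by (intro sets.Un sets.finite_UN) auto
  qed
  also have "\<dots> \<le> prob ?B + prob (\<Union>k\<in>?W. ?C k)"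
    using fin events by (intro measure_Un_le sets.finite_UN) auto
  also have "prob (\<Union>k\<in>?W. ?C k) \<le> (\<Sum>k\<in>?W. prob (?C k))"
    using fin events by (intro finite_measure_subadditive_finite) auto
  finally show ?thesis by simp
qed

text \<open>Disjointness of the cells keeps their number out of the final bound: the error
  probabilities are averaged with weights of total at most 1.\<close>

lemma sum_prob_cells_le_1:
  assumes "G \<subseteq> dyadic_index J"
  shows "(\<Sum>k\<in>G. prob {z \<in> space \<pi>. fst z \<in> dyadic_cell J k}) \<le> 1"
proof -
  have [measurable]: "dyadic_cell J k \<in> sets lebesgue_cube" if "k \<in> G" for k
    using that assms sets_dyadic_cell by auto
  have "(\<Sum>k\<in>G. prob {z \<in> space \<pi>. fst z \<in> dyadic_cell J k}) =
      prob (\<Union>k\<in>G. {z \<in> space \<pi>. fst z \<in> dyadic_cell J k})"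
  proof (rule finite_measure_finite_Union[symmetric])
    show "finite G" using assms by (rule finite_subset) simp
    show "disjoint_family_on (\<lambda>k. {z \<in> space \<pi>. fst z \<in> dyadic_cell J k}) G"
      using assms by (auto simp: disjoint_family_on_def dest: dyadic_cell_inj)
  qed auto
  thus ?thesis by simp
qed

text \<open>The indicator of a wrong vote is dominated by the product of the \<open>L k\<close>,
  which makes the bound for fixed data integrable in the data. The density bound \<open>A\<close>
  controls the remaining cells and \<open>a\<close> the probability of each voting cell.\<close>

lemma estimator_risk_integral_le:
  fixes p \<eta> :: "real ^ 'd \<Rightarrow> real"
  assumes sum: "summable (weight CARD('d) w)"
    and aA: "0 < a" "a \<le> A"
    and h: "0 < h" "h \<le> 1"
    and \<eta>: "regression_function \<pi> \<eta>"
    and p: "p \<in> borel_measurable lebesgue_cube"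
    and marg: "marginal \<pi> = density lebesgue_cube (\<lambda>x. ennreal (p x))"
    and bounds: "\<And>x. x \<in> unit_cube \<Longrightarrow> a \<le> p x \<and> p x \<le> A"
    and SMA: "AE z in \<pi>. h \<le> \<bar>2 * \<eta> (fst z) - 1\<bar>"
    and bayes: "bayes_rule \<eta> \<in> dyadic_class w"
    and tail: "0 \<le> r" "(\<Sum>i. weight CARD('d) w (i + (J + 1))) \<le> r"
  shows "(LINT D|data_law \<pi> n. risk \<pi> (estimator n J D) - risk \<pi> (bayes_rule \<eta>)) \<le>
    A * r + exp (- (real n * a * (1 - exp (- h\<^sup>2 / 2)) / 2 ^ (CARD('d) * J)))"
proof -
  let ?C = "dyadic_cell J" and ?E = "exp (- (real n * a * (1 - exp (- h\<^sup>2 / 2)) / 2 ^ (CARD('d) * J)))"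
  obtain G \<sigma> where G: "G \<subseteq> dyadic_index J" and \<sigma>: "\<And>k. k \<in> G \<Longrightarrow> \<sigma> k \<in> {-1, 1}"
    and const: "\<And>k. k \<in> G \<Longrightarrow> AE x in lebesgue_cube. x \<in> ?C k \<longrightarrow> bayes_rule \<eta> x = \<sigma> k"
    and rest: "emeasure lebesgue_cube (unit_cube - (\<Union>k\<in>G. ?C k))
       \<le> ennreal (\<Sum>i. weight CARD('d) w (i + (J + 1)))"
    by (rule dyadic_class_approximation[OF bayes sum, where J = J]) (rule that)
  have fin: "finite G" using G by (rule finite_subset) simp
  have C: "?C k \<in> sets lebesgue_cube" if "k \<in> G" for k
    using that G sets_dyadic_cell by auto
  have "absolutely_continuous lebesgue_cube (marginal \<pi>)"
    unfolding marg by (rule absolutely_continuousI_density) (use p in measurable)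
  note const' = AE_X[OF this const]
  define q where "q k = prob {z \<in> space \<pi>. fst z \<in> ?C k}" for k
  define L where "L k z = exp (- h * (\<phi> J k (fst z) * (\<sigma> k * snd z)))" for k and z :: "(real ^ 'd) \<times> real"
  define B where "B = prob {z \<in> space \<pi>. fst z \<in> unit_cube - (\<Union>k\<in>G. ?C k)}"
  have B_le: "B \<le> A * r"
  proof -
    have "unit_cube - (\<Union>k\<in>G. ?C k) \<in> sets lebesgue_cube"
      using fin by (subst space_lebesgue_cube[symmetric]) (intro sets.Diff sets.top sets.finite_UN C)
    thus ?thesis
      unfolding B_def using aA bounds tail order_trans[OF rest ennreal_leI[OF tail(2)]]
      by (intro prob_X_le[OF p marg]) auto
  qed
  have margin: "h * q k \<le> prob {z \<in> space \<pi>. fst z \<in> ?C k \<and> snd z = \<sigma> k}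
      - prob {z \<in> space \<pi>. fst z \<in> ?C k \<and> snd z = - \<sigma> k}" if "k \<in> G" for k
    unfolding q_def using SMA \<sigma> const' that by (intro margin[OF \<eta> C]) auto
  have mgf: "integrable (data_law \<pi> n) (\<lambda>D. \<Prod>i\<in>{1..n}. L k (D i))"
    "(\<integral>D. (\<Prod>i\<in>{1..n}. L k (D i)) \<partial>data_law \<pi> n) \<le>
      exp (- (real n * q k * (1 - exp (- h\<^sup>2 / 2))))" if k: "k \<in> G" for k
    using data_law_margin_mgf[OF C[OF k] \<sigma>[OF k] less_imp_le[OF h(1)] h(2), of n] margin[OF k]
    unfolding L_def q_def by blast+
  have mgf_le: "(\<integral>D. (\<Prod>i\<in>{1..n}. L k (D i)) \<partial>data_law \<pi> n) \<le> ?E" if k: "k \<in> G" for k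
  proof -
    have "a * (1 / 2 ^ (CARD('d) * J)) \<le> q k"
      unfolding q_def using aA bounds k G emeasure_dyadic_cell[of k J]
      by (intro prob_X_ge[OF p marg]) (auto intro!: C)
    hence "real n * (1 - exp (- h\<^sup>2 / 2)) * (a * (1 / 2 ^ (CARD('d) * J))) \<le>
        real n * (1 - exp (- h\<^sup>2 / 2)) * q k"
      by (intro mult_left_mono) auto
    hence "exp (- (real n * q k * (1 - exp (- h\<^sup>2 / 2)))) \<le> ?E"
      by (simp add: mult_ac)
    with mgf(2)[OF k] show ?thesis by (rule order_trans)
  qed
  interpret P: product_prob_space "\<lambda>_. \<pi>" "{1..n}" by unfold_locales
  interpret DL: prob_space "data_law \<pi> n" unfolding data_law_def by (rule P.prob_space_axioms)
  have int: "integrable (data_law \<pi> n) (\<lambda>D. B + (\<Sum>k\<in>G. q k * (\<Prod>i\<in>{1..n}. L k (D i))))"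
    by (intro Bochner_Integration.integrable_add Bochner_Integration.integrable_sum
        integrable_mult_right mgf(1)) auto
  have "(LINT D|data_law \<pi> n. risk \<pi> (estimator n J D) - risk \<pi> (bayes_rule \<eta>)) \<le>
      (LINT D|data_law \<pi> n. B + (\<Sum>k\<in>G. q k * (\<Prod>i\<in>{1..n}. L k (D i))))"
    \<comment> \<open>\<open>integral_mono'\<close> spares the measurability of the left integrand in the data.\<close>
  proof (rule integral_mono'[OF int])
    fix D assume D: "D \<in> space (data_law \<pi> n)"
    hence D': "snd (D i) \<in> {-1, 1}" if "i \<in> {1..n}" for i
      using that by (auto simp: data_law_def space_PiM space_eq PiE_def Pi_def mem_Times_iff)
    have "risk \<pi> (estimator n J D) - risk \<pi> (bayes_rule \<eta>) \<le>
        B + (\<Sum>k\<in>{k \<in> G. estimator_coeff n J D k \<noteq> \<sigma> k}. q k)"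
      unfolding B_def q_def
      by (rule risk_estimator_le[OF bayes_rule_prediction_rule[OF \<eta>] G const'])
    also have "(\<Sum>k\<in>{k \<in> G. estimator_coeff n J D k \<noteq> \<sigma> k}. q k) \<le>
        (\<Sum>k\<in>{k \<in> G. estimator_coeff n J D k \<noteq> \<sigma> k}. q k * (\<Prod>i\<in>{1..n}. L k (D i)))"
    proof (rule sum_mono)
      fix k assume k: "k \<in> {k \<in> G. estimator_coeff n J D k \<noteq> \<sigma> k}"
      have "1 \<le> (\<Prod>i\<in>{1..n}. L k (D i))"
        unfolding L_def using k \<sigma> h by (intro estimator_coeff_error[OF D']) auto
      hence "q k * 1 \<le> q k * (\<Prod>i\<in>{1..n}. L k (D i))"
        by (rule mult_left_mono) (simp add: q_def)
      thus "q k \<le> q k * (\<Prod>i\<in>{1..n}. L k (D i))" by simp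
    qed
    also have "\<dots> \<le> (\<Sum>k\<in>G. q k * (\<Prod>i\<in>{1..n}. L k (D i)))"
      using fin by (intro sum_mono2) (auto simp: q_def L_def intro!: mult_nonneg_nonneg prod_nonneg)
    finally show "risk \<pi> (estimator n J D) - risk \<pi> (bayes_rule \<eta>) \<le>
        B + (\<Sum>k\<in>G. q k * (\<Prod>i\<in>{1..n}. L k (D i)))" by simp
  next
    fix D
    \<comment> \<open>A non-integrable left integrand would have integral 0 by convention;
      nonnegativity of the majorant covers that case.\<close>
    show "0 \<le> B + (\<Sum>k\<in>G. q k * (\<Prod>i\<in>{1..n}. L k (D i)))"
      by (auto simp: B_def q_def L_def intro!: add_nonneg_nonneg sum_nonneg mult_nonneg_nonneg prod_nonneg)
  qed
  also have "\<dots> = B + (\<Sum>k\<in>G. q k * (\<integral>D. (\<Prod>i\<in>{1..n}. L k (D i)) \<partial>data_law \<pi> n))"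
    using mgf(1) by (simp add: Bochner_Integration.integral_add Bochner_Integration.integral_sum DL.prob_space)
  also have "\<dots> \<le> A * r + (\<Sum>k\<in>G. q k * ?E)"
    using B_le mgf_le by (intro add_mono sum_mono mult_left_mono) (auto simp: q_def)
  also have "\<dots> = A * r + (\<Sum>k\<in>G. q k) * ?E" by (simp add: sum_distrib_right)
  also have "\<dots> \<le> A * r + 1 * ?E"
    unfolding q_def by (intro add_left_mono mult_right_mono sum_prob_cells_le_1 G) auto
  finally show ?thesis by simp
qed

end

text \<open>The tails of a convergent series tend to 0, so the least \<open>J\<close> exists and
  satisfies its defining inequality.\<close>

lemma J_eps_tail:
  assumes "summable (weight d w)" "0 < \<epsilon> / A"
  shows "(\<Sum>i. weight d w (i + (J_eps d w A \<epsilon> + 1))) < \<epsilon> / A"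
  unfolding J_eps_def
proof (rule LeastI_ex)
  obtain N where "\<And>m. N \<le> m \<Longrightarrow> norm (\<Sum>i. weight d w (i + m)) < \<epsilon> / A"
    using suminf_exist_split[OF assms(2,1)] by blast
  \<comment> \<open>The tail attached to \<open>J\<close> starts at \<open>J + 1\<close>, hence the
    shift by one.\<close>
  from this[of "N + 1"] have "norm (\<Sum>i. weight d w (i + (N + 1))) < \<epsilon> / A" by simp
  thus "\<exists>J. (\<Sum>i. weight d w (i + (J + 1))) < \<epsilon> / A" by (intro exI[of _ N]) auto
qed

theorem theorem3:
  fixes \<pi> :: "((real ^ 'd) \<times> real) measure"
    and \<eta> p :: "real ^ 'd \<Rightarrow> real"
    and w :: "nat \<Rightarrow> real"
    and a A h \<epsilon> :: real
    and n :: nat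
  assumes w_nonneg: "\<And>j. 0 \<le> w j"
    and w_summable: "summable (weight CARD('d) w)"
    and aA: "0 < a" "a \<le> A"
    and h: "0 < h" "h \<le> 1"
    and \<pi>: "prob_space \<pi>" "sets \<pi> = sets sample_space"
    and \<eta>: "regression_function \<pi> \<eta>"
    and A1: "p \<in> borel_measurable lebesgue_cube"
      "marginal \<pi> = density lebesgue_cube (\<lambda>x. ennreal (p x))"
      "\<And>x. x \<in> unit_cube \<Longrightarrow> a \<le> p x \<and> p x \<le> A"
    and SMA: "AE z in \<pi>. h \<le> \<bar>2 * \<eta> (fst z) - 1\<bar>"
    and bayes: "bayes_rule \<eta> \<in> dyadic_class w"
    and n: "1 \<le> n"
    and \<epsilon>: "0 < \<epsilon>"
  shows "excess_risk \<pi> n (estimator n (J_eps CARD('d) w A \<epsilon>)) =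
           (LINT D|data_law \<pi> n.
              risk_dist \<pi> (estimator n (J_eps CARD('d) w A \<epsilon>) D) (bayes_rule \<eta>)) \<and>
         (LINT D|data_law \<pi> n.
              risk_dist \<pi> (estimator n (J_eps CARD('d) w A \<epsilon>) D) (bayes_rule \<eta>))
           \<le> (1 + A) * \<epsilon> +
             exp (- (real n * a * (1 - exp (- h\<^sup>2 / 2)) / 2 ^ (CARD('d) * J_eps CARD('d) w A \<epsilon>)))"
proof -
  interpret classification \<pi>
    using \<pi> by (intro classification.intro classification_axioms.intro)
  define J where "J = J_eps CARD('d) w A \<epsilon>"
  have A: "0 < A" using aA by linarith
  have "excess_risk \<pi> n (estimator n J) =
      (LINT D|data_law \<pi> n. risk \<pi> (estimator n J D) - risk \<pi> (bayes_rule \<eta>))"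
    by (simp add: excess_risk_def bayes_risk_eq[OF \<eta>])
  \<comment> \<open>Optimality of the Bayes rule removes the absolute value in
    \<open>risk_dist\<close>.\<close>
  moreover have "(LINT D|data_law \<pi> n. risk_dist \<pi> (estimator n J D) (bayes_rule \<eta>)) =
      (LINT D|data_law \<pi> n. risk \<pi> (estimator n J D) - risk \<pi> (bayes_rule \<eta>))"
    using bayes_rule_optimal[OF \<eta> estimator_prediction_rule] by (simp add: risk_dist_def)
  moreover have "(LINT D|data_law \<pi> n. risk \<pi> (estimator n J D) - risk \<pi> (bayes_rule \<eta>)) \<le>
      A * (\<epsilon> / A) + exp (- (real n * a * (1 - exp (- h\<^sup>2 / 2)) / 2 ^ (CARD('d) * J)))"
    using J_eps_tail[OF w_summable, of \<epsilon> A] A \<epsilon>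
    by (intro estimator_risk_integral_le[OF w_summable aA h \<eta> A1(1,2) _ SMA bayes])
      (auto simp: J_def dest: A1(3))
  \<comment> \<open>The tail bound \<open>\<epsilon> / A\<close> times the density bound
    \<open>A\<close> contributes \<open>\<epsilon>\<close>, which is at most the stated
    \<open>(1 + A) * \<epsilon>\<close>.\<close>
  moreover have "A * (\<epsilon> / A) \<le> (1 + A) * \<epsilon>"
    using A \<epsilon> by (simp add: field_simps)
  ultimately show ?thesis unfolding J_def by linarith
qed

end
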